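(* Let $\nu:\mathbb{R}^d\to\mathbb{R}_+$ be a normalization function with associated Capra-coupling $c_\nu$, and let $f:\mathbb{R}^d\to\overline{\mathbb{R}}$ be any function. For all $x\in\mathbb{R}^d$, the Capra-subdifferential $\partial_{c_\nu}f(x)$ is a closed convex set. Moreover, if the function $f$ is 0-homogeneous, then: (a) $\partial_{c_\nu}f(0)=\partial\bigl(f\dotplus\delta_{B_\nu}\bigr)(0)$; (b) for every $s\in\mathbb{R}^d$, if $s\in S_\nu$ and $f^{c_\nu\star'}(s)=f(s)$, then $\partial_{c_\nu}f(s)=\partial\bigl(f^{c_\nu\star'}\bigr)(s)$. Here $\partial$ denotes the Rockafellar-Moreau subdifferential.
   Context: $d$ is a positive integer, $\mathbb{R}^d$ has scalar product $\langle\cdot,\cdot\rangle$, and $\overline{\mathbb{R}}=[-\infty,+\infty]$. The Moreau upper addition $\dotplus$ extends the usual addition with $(+\infty)\dotplus(-\infty)=(-\infty)\dotplus(+\infty)=+\infty$; the Moreau lower addition, written $+_{\ell}$, extends it with $(+\infty)+_{\ell}(-\infty)=(-\infty)+_{\ell}(+\infty)=-\infty$. For $W\subset\mathbb{R}^d$, $\delta_W(w)=0$ if $w\in W$ and $+\infty$ otherwise. A function $f:\mathbb{R}^d\to\overline{\mathbb{R}}$ is 0-homogeneous if $f(\rho x)=f(x)$ for all $\rho\in\mathbb{R}\setminus\{0\}$ and all $x\in\mathbb{R}^d$. A normalization function is a function $\nu:\mathbb{R}^d\to\mathbb{R}_+$ that is absolutely 1-homogeneous ($\nu(\rho x)=|\rho|\nu(x)$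 for all $\rho\in\mathbb{R}\setminus\{0\}$, $x\in\mathbb{R}^d$) and such that $\nu(x)=0$ if and only if $x=0$ (subadditivity is not required). Set $S_\nu=\{x:\nu(x)=1\}$ and $B_\nu=\{x:\nu(x)\le 1\}$. The Capra-coupling associated with $\nu$ is $c_\nu:\mathbb{R}^d\times\mathbb{R}^d\to\mathbb{R}$, $c_\nu(x,y)=\langle x,y\rangle/\nu(x)$ if $x\ne 0$, and $c_\nu(0,y)=0$. The $c_\nu$-Fenchel-Moreau conjugate of $f$ is $f^{c_\nu}(y)=\sup_{x\in\mathbb{R}^d}\bigl(c_\nu(x,y)+_{\ell}(-f(x))\bigr)$. The Fenchel conjugate of $f$ is $f^\star(y)=\sup_{x\in\mathbb{R}^d}\bigl(\langle x,y\rangle+_{\ell}(-f(x))\bigr)$, and for $g:\mathbb{R}^d\to\overline{\mathbb{R}}$ (a function of the dual variable) $g^{\star'}(x)=\sup_{y\in\mathbb{R}^d}\bigl(\langle x,y\rangle+_{\ell}(-g(y))\bigr)$. Set $f^{c_\nu\star'}=(f^{c_\nu})^{\star'}$. The Capra-subdifferential of $f$ at $x$ is $\partial_{c_\nu}f(x)=\{y\in\mathbb{R}^d: f^{c_\nu}(y)=c_\nu(x,y)+_{\ell}(-f(x))\}$. The Rockafellar-Moreau subdifferential of $f$ at $x$ is $\partial f(x)=\{y\in\mathbb{R}^d: f^{\star}(y)=\langle x,y\rangle+_{\ell}(-f(x))\}$. *)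

theory Defs
  imports "HOL-Analysis.Analysis"
begin

text \<open>
  Addition on \<^typ>\<open>ereal\<close> is the Moreau upper addition: opposite infinities add up to
  \<open>\<infinity>\<close>. The Moreau lower addition is its conjugate under negation.
\<close>

lemma ereal_add_is_upper_add:
  "(\<infinity>::ereal) + (-\<infinity>) = \<infinity>"
  "(-\<infinity>::ereal) + \<infinity> = \<infinity>"
  by simp_all

definition lower_add :: "ereal \<Rightarrow> ereal \<Rightarrow> ereal"  (infixl "+\<^sub>l" 65) where
  "a +\<^sub>l b = - ((- a) + (- b))"

lemma lower_add_infinity:
  "\<infinity> +\<^sub>l (-\<infinity>) = -\<infinity>"
  "(-\<infinity>) +\<^sub>l \<infinity> = -\<infinity>"
  by (simp_all add: lower_add_def)

lemma lower_add_eq_plus: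
  assumes "\<not> (a = \<infinity> \<and> b = -\<infinity>)" and "\<not> (a = -\<infinity> \<and> b = \<infinity>)"
  shows "a +\<^sub>l b = a + b"
  using assms by (cases a; cases b) (simp_all add: lower_add_def)

definition indicator_fun :: "'a set \<Rightarrow> 'a \<Rightarrow> ereal" where
  "indicator_fun W w = (if w \<in> W then 0 else \<infinity>)"

definition zero_homogeneous :: "(real ^ 'n \<Rightarrow> ereal) \<Rightarrow> bool" where
  "zero_homogeneous f \<longleftrightarrow> (\<forall>\<rho> x. \<rho> \<noteq> 0 \<longrightarrow> f (\<rho> *\<^sub>R x) = f x)"

definition normalization_fun :: "(real ^ 'n \<Rightarrow> real) \<Rightarrow> bool" where
  "normalization_fun \<nu> \<longleftrightarrow>
     (\<forall>x. 0 \<le> \<nu> x) \<and>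
     (\<forall>\<rho> x. \<rho> \<noteq> 0 \<longrightarrow> \<nu> (\<rho> *\<^sub>R x) = \<bar>\<rho>\<bar> * \<nu> x) \<and>
     (\<forall>x. \<nu> x = 0 \<longleftrightarrow> x = 0)"

definition unit_sphere :: "(real ^ 'n \<Rightarrow> real) \<Rightarrow> (real ^ 'n) set" where
  "unit_sphere \<nu> = {x. \<nu> x = 1}"

definition unit_ball :: "(real ^ 'n \<Rightarrow> real) \<Rightarrow> (real ^ 'n) set" where
  "unit_ball \<nu> = {x. \<nu> x \<le> 1}"

definition capra_coupling :: "(real ^ 'n \<Rightarrow> real) \<Rightarrow> real ^ 'n \<Rightarrow> real ^ 'n \<Rightarrow> real" where
  "capra_coupling \<nu> x y = (if x = 0 then 0 else (x \<bullet> y) / \<nu> x)"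

definition capra_conj :: "(real ^ 'n \<Rightarrow> real) \<Rightarrow> (real ^ 'n \<Rightarrow> ereal) \<Rightarrow> real ^ 'n \<Rightarrow> ereal" where
  "capra_conj \<nu> f y = (SUP x. ereal (capra_coupling \<nu> x y) +\<^sub>l (- f x))"

definition fenchel_conj :: "(real ^ 'n \<Rightarrow> ereal) \<Rightarrow> real ^ 'n \<Rightarrow> ereal" where
  "fenchel_conj f y = (SUP x. ereal (x \<bullet> y) +\<^sub>l (- f x))"

definition fenchel_conj_dual :: "(real ^ 'n \<Rightarrow> ereal) \<Rightarrow> real ^ 'n \<Rightarrow> ereal" where
  "fenchel_conj_dual g x = (SUP y. ereal (x \<bullet> y) +\<^sub>l (- g y))"

definition capra_biconj :: "(real ^ 'n \<Rightarrow> real) \<Rightarrow> (real ^ 'n \<Rightarrow> ereal) \<Rightarrow> real ^ 'n \<Rightarrow> ereal" where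
  "capra_biconj \<nu> f = fenchel_conj_dual (capra_conj \<nu> f)"

definition capra_subdiff :: "(real ^ 'n \<Rightarrow> real) \<Rightarrow> (real ^ 'n \<Rightarrow> ereal) \<Rightarrow> real ^ 'n \<Rightarrow> (real ^ 'n) set" where
  "capra_subdiff \<nu> f x = {y. capra_conj \<nu> f y = ereal (capra_coupling \<nu> x y) +\<^sub>l (- f x)}"

definition rm_subdiff :: "(real ^ 'n \<Rightarrow> ereal) \<Rightarrow> real ^ 'n \<Rightarrow> (real ^ 'n) set" where
  "rm_subdiff f x = {y. fenchel_conj f y = ereal (x \<bullet> y) +\<^sub>l (- f x)}"

end

theory Submission imports Defs
begin

text \<open>
  A point \<open>y\<close> lies in a subdifferential iff the supremum defining the conjugate is attained at
  \<open>x\<close>; since couplings are finite, this is a system of closed half-space conditions on \<open>y\<close>, or is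
  constant in \<open>y\<close> when \<open>f x\<close> is infinite. If \<open>f\<close> is 0-homogeneous, then on every line through the
  origin, with the origin removed, the supremum of \<open>\<langle>x, y\<rangle> - f x\<close>
  over the unit ball is reached on the unit sphere, so that
  the Capra conjugate of \<open>f\<close> is the Fenchel conjugate of \<open>f + \<delta>\<^bsub>B\<^esub>\<close>. This gives (a) at once, and
  (b) by the identity \<open>h\<^sup>\<star>\<^sup>\<star>\<^sup>\<star> = h\<^sup>\<star>\<close>.
\<close>

text \<open>With a finite first summand, opposite infinities never meet, so every conjugate can be
  handled with the usual subtraction on \<open>ereal\<close>.\<close>

lemma real_lower_add_uminus: "ereal r +\<^sub>l (- a) = ereal r - a"
  by (cases a) (simp_all add: lower_add_def)

text \<open>The term at \<open>x\<close> is one of those under the supremum, so only the upper bound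
  is a condition on \<open>y\<close>.\<close>

lemma capra_subdiff_iff:
  "y \<in> capra_subdiff \<nu> f x \<longleftrightarrow>
     (\<forall>z. ereal (capra_coupling \<nu> z y) - f z \<le> ereal (capra_coupling \<nu> x y) - f x)"
proof -
  have "ereal (capra_coupling \<nu> x y) - f x \<le> capra_conj \<nu> f y"
    unfolding capra_conj_def real_lower_add_uminus by (rule SUP_upper) simp
  moreover have "capra_conj \<nu> f y \<le> ereal (capra_coupling \<nu> x y) - f x \<longleftrightarrow>
     (\<forall>z. ereal (capra_coupling \<nu> z y) - f z \<le> ereal (capra_coupling \<nu> x y) - f x)"
    unfolding capra_conj_def real_lower_add_uminus by (simp add: SUP_le_iff)
  ultimately show ?thesis
    unfolding capra_subdiff_def real_lower_add_uminus by auto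
qed

text \<open>Makes the linearity in \<open>y\<close> visible: the fixed vector is the normalized
  \<open>x\<close>, or 0 at the origin.\<close>

lemma capra_coupling_eq_inner:
  "capra_coupling \<nu> x y = (if x = 0 then 0 else (1 / \<nu> x) *\<^sub>R x) \<bullet> y"
  by (simp add: capra_coupling_def)

text \<open>If \<open>a\<close> or \<open>b\<close> is infinite, the truth of the inequality does
  not depend on \<open>y\<close>; otherwise it describes a half-space, or a trivial set when
  \<open>u = v\<close>.\<close>

lemma closed_convex_shifted_inner_le:
  fixes u v :: "'a::euclidean_space" and a b :: ereal
  shows "closed {y. ereal (u \<bullet> y) - a \<le> ereal (v \<bullet> y) - b} \<and>
    convex {y. ereal (u \<bullet> y) - a \<le> ereal (v \<bullet> y) - b}"
proof (cases "\<bar>a\<bar> = \<infinity> \<or> \<bar>b\<bar> = \<infinity>")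
  case True
  then have "{y. ereal (u \<bullet> y) - a \<le> ereal (v \<bullet> y) - b} = {} \<or>
    {y. ereal (u \<bullet> y) - a \<le> ereal (v \<bullet> y) - b} = UNIV"
    by (cases a; cases b) auto
  then show ?thesis
    by auto
next
  case False
  then obtain p q where "a = ereal p" "b = ereal q"
    by (cases a; cases b) auto
  then have "{y. ereal (u \<bullet> y) - a \<le> ereal (v \<bullet> y) - b} = {y. (u - v) \<bullet> y \<le> p - q}"
    by (auto simp: inner_diff_left)
  then show ?thesis
    by (simp add: closed_halfspace_le convex_halfspace_le)
qed

lemma closed_convex_capra_subdiff:
  "closed (capra_subdiff \<nu> f x) \<and> convex (capra_subdiff \<nu> f x)"
proof -
  have "capra_subdiff \<nu> f x = (\<Inter>z. {y. ereal (capra_coupling \<nu> z y) - f z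
      \<le> ereal (capra_coupling \<nu> x y) - f x})"
    by (auto simp: capra_subdiff_iff)
  moreover have "closed (\<Inter>z. {y. ereal (capra_coupling \<nu> z y) - f z
      \<le> ereal (capra_coupling \<nu> x y) - f x})"
    unfolding capra_coupling_eq_inner
    by (intro closed_INT ballI closed_convex_shifted_inner_le [THEN conjunct1])
  moreover have "convex (\<Inter>z. {y. ereal (capra_coupling \<nu> z y) - f z
      \<le> ereal (capra_coupling \<nu> x y) - f x})"
    unfolding capra_coupling_eq_inner
    by (intro convex_INT closed_convex_shifted_inner_le [THEN conjunct2])
  ultimately show ?thesis
    by simp
qed

text \<open>Both inequalities come from Fenchel-Young: one directly, the other because the
  biconjugate lies below \<open>h\<close> and conjugation reverses order.\<close>

lemma fenchel_conj_triple:
  "fenchel_conj (fenchel_conj_dual (fenchel_conj h)) = fenchel_conj h"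
proof (rule ext, rule antisym)
  fix y
  show "fenchel_conj (fenchel_conj_dual (fenchel_conj h)) y \<le> fenchel_conj h y"
    unfolding fenchel_conj_def [of "fenchel_conj_dual (fenchel_conj h)"] real_lower_add_uminus
  proof (rule SUP_least)
    fix x
    have "ereal (x \<bullet> y) - fenchel_conj h y \<le> fenchel_conj_dual (fenchel_conj h) x"
      unfolding fenchel_conj_dual_def real_lower_add_uminus by (rule SUP_upper) simp
    \<comment> \<open>The two conjugate values may trade sides even when infinite, since the scalar
      product is finite.\<close>
    then show "ereal (x \<bullet> y) - fenchel_conj_dual (fenchel_conj h) x \<le> fenchel_conj h y"
      by (cases "fenchel_conj h y"; cases "fenchel_conj_dual (fenchel_conj h) x") auto
  qed
  have biconj_le: "fenchel_conj_dual (fenchel_conj h) x \<le> h x" for x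
    unfolding fenchel_conj_dual_def real_lower_add_uminus
  proof (rule SUP_least)
    fix z
    have "ereal (x \<bullet> z) - h x \<le> fenchel_conj h z"
      unfolding fenchel_conj_def real_lower_add_uminus by (rule SUP_upper) simp
    then show "ereal (x \<bullet> z) - fenchel_conj h z \<le> h x"
      by (cases "fenchel_conj h z"; cases "h x") auto
  qed
  show "fenchel_conj h y \<le> fenchel_conj (fenchel_conj_dual (fenchel_conj h)) y"
    unfolding fenchel_conj_def [of h y] fenchel_conj_def [of "fenchel_conj_dual _"]
      real_lower_add_uminus
    by (intro SUP_mono' ereal_minus_mono order_refl biconj_le)
qed

lemma capra_conj_eq_fenchel_conj:
  fixes \<nu> :: "real ^ 'n \<Rightarrow> real"
  assumes \<nu>: "normalization_fun \<nu>" and f: "zero_homogeneous f"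
  shows "capra_conj \<nu> f = fenchel_conj (\<lambda>x. f x + indicator_fun (unit_ball \<nu>) x)"
proof (rule ext, rule antisym)
  fix y
  have scale: "\<nu> (r *\<^sub>R x) = \<bar>r\<bar> * \<nu> x" "f (r *\<^sub>R x) = f x" if "r \<noteq> 0" for r x
    using \<nu> f that by (auto simp: normalization_fun_def zero_homogeneous_def)
  have pos: "\<nu> x > 0" if "x \<noteq> 0" for x
    using \<nu> that by (metis less_eq_real_def normalization_fun_def)
  have zero: "\<nu> 0 = 0"
    using \<nu> by (simp add: normalization_fun_def)
  let ?h = "\<lambda>x. f x + indicator_fun (unit_ball \<nu>) x"
  show "capra_conj \<nu> f y \<le> fenchel_conj ?h y"
    unfolding capra_conj_def fenchel_conj_def real_lower_add_uminus
  proof (rule SUP_mono)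
    fix x
    \<comment> \<open>Normalizing keeps \<open>f\<close> by 0-homogeneity and turns the coupling
      into a scalar product.\<close>
    define u where "u = (if x = 0 then 0 else (1 / \<nu> x) *\<^sub>R x)"
    have "f u = f x" "u \<in> unit_ball \<nu>"
      using pos [of x] by (auto simp: u_def scale zero unit_ball_def)
    then show "\<exists>u\<in>UNIV. ereal (capra_coupling \<nu> x y) - f x \<le> ereal (u \<bullet> y) - ?h u"
      by (intro bexI [of _ u]) (simp_all add: capra_coupling_eq_inner u_def indicator_fun_def)
  qed
  show "fenchel_conj ?h y \<le> capra_conj \<nu> f y"
    unfolding capra_conj_def fenchel_conj_def real_lower_add_uminus
  proof (rule SUP_mono)
    fix x
    show "\<exists>z\<in>UNIV. ereal (x \<bullet> y) - ?h x \<le> ereal (capra_coupling \<nu> z y) - f z"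
    proof (cases "x \<in> unit_ball \<nu>")
      case False
      \<comment> \<open>Off the ball \<open>?h x\<close> is \<infinity>, even where
        \<open>f x\<close> is -\<infinity>, so the left side is -\<infinity> and any
        \<open>z\<close> will do.\<close>
      then show ?thesis
        by (simp add: indicator_fun_def)
    next
      case True
      \<comment> \<open>Division by \<open>\<nu> x\<close>, which is at most 1, can only increase a
        nonnegative scalar product. The sign change ensures nonnegativity and preserves both
        \<open>\<nu>\<close> and \<open>f\<close>.\<close>
      define z where "z = (if x \<bullet> y \<ge> 0 then x else - x)"
      have z: "\<nu> z = \<nu> x" "f z = f x"
        using scale [of "-1" x] by (auto simp: z_def)
      have "x \<bullet> y \<le> capra_coupling \<nu> z y"
      proof (cases "x = 0")
        case False
        have "\<bar>x \<bullet> y\<bar> * \<nu> x \<le> \<bar>x \<bullet> y\<bar>"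
          using True by (intro mult_left_le) (auto simp: unit_ball_def)
        then have "\<bar>x \<bullet> y\<bar> \<le> \<bar>x \<bullet> y\<bar> / \<nu> x"
          using pos [OF False] by (simp add: pos_le_divide_eq)
        then have "x \<bullet> y \<le> \<bar>x \<bullet> y\<bar> / \<nu> x"
          by linarith
        also have "\<dots> = capra_coupling \<nu> z y"
          using False z by (auto simp: capra_coupling_def z_def)
        finally show ?thesis .
      qed (simp add: z_def capra_coupling_def)
      then show ?thesis
        using True z(2) by (intro bexI [of _ z]) (auto simp: indicator_fun_def intro: ereal_minus_mono)
    qed
  qed
qed

theorem proposition7:
  fixes \<nu> :: "real ^ 'n \<Rightarrow> real" and f :: "real ^ 'n \<Rightarrow> ereal"
  assumes "normalization_fun \<nu>"
  shows "(\<forall>x. closed (capra_subdiff \<nu> f x) \<and> convex (capra_subdiff \<nu> f x)) \<and>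
    (zero_homogeneous f \<longrightarrow>
      capra_subdiff \<nu> f 0 = rm_subdiff (\<lambda>x. f x + indicator_fun (unit_ball \<nu>) x) 0 \<and>
      (\<forall>s. s \<in> unit_sphere \<nu> \<and> capra_biconj \<nu> f s = f s \<longrightarrow>
         capra_subdiff \<nu> f s = rm_subdiff (capra_biconj \<nu> f) s))"
proof (intro conjI allI impI; (elim conjE)?)
  show "closed (capra_subdiff \<nu> f x)" "convex (capra_subdiff \<nu> f x)" for x
    using closed_convex_capra_subdiff by blast+
next
  assume f: "zero_homogeneous f"
  note conj = capra_conj_eq_fenchel_conj [OF assms f]
  have zero: "\<nu> 0 = 0"
    using assms by (simp add: normalization_fun_def)
  then show "capra_subdiff \<nu> f 0 = rm_subdiff (\<lambda>x. f x + indicator_fun (unit_ball \<nu>) x) 0"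
    by (simp add: capra_subdiff_def rm_subdiff_def conj capra_coupling_def
        indicator_fun_def unit_ball_def)
  fix s
  assume s: "s \<in> unit_sphere \<nu>" "capra_biconj \<nu> f s = f s"
  have "capra_coupling \<nu> s y = s \<bullet> y" for y
    using s(1) by (simp add: capra_coupling_def unit_sphere_def)
  \<comment> \<open>The Capra conjugate is itself a Fenchel conjugate, so conjugating it twice more
    gives it back.\<close>
  moreover have "fenchel_conj (capra_biconj \<nu> f) = capra_conj \<nu> f"
    by (simp add: capra_biconj_def conj fenchel_conj_triple)
  ultimately show "capra_subdiff \<nu> f s = rm_subdiff (capra_biconj \<nu> f) s"
    by (simp add: capra_subdiff_def rm_subdiff_def s(2))
qed

end
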